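(* Let $\zeta=e^{\pi i/4}$ and let $$A=\begin{pmatrix}0&0&0&0&0&0\\0&4&2&6&6&2\\0&2&4&3&7&6\\0&6&1&4&2&5\\0&6&5&2&4&1\\0&2&6&7&3&4\end{pmatrix}$$ with entries in $\mathbb{Z}/8\mathbb{Z}$ and rows and columns indexed by $0,\dots,5$. Let $H$ be the $6\times 6$ complex matrix with entries $H_{rs}=\zeta^{A_{rs}}$, let $h_0,\dots,h_5\in\mathbb{C}^6$ be its columns, and let $\Phi_{19}$ be the $6\times 6$ array of vectors with $(i,j)$ entry $\frac{1}{\sqrt6}(h_i\odot h_j)\in\mathbb{C}^6$, $0\le i,j\le 5$. Then $\Phi_{19}$ is a quantum Latin square of order $6$ and its cardinality is $19$.
   Context: For $x,y\in\mathbb{C}^n$, $x\odot y=(x_0y_0,\dots,x_{n-1}y_{n-1})^{\mathsf T}$ is the entrywise (Schur) product. A quantum Latin square of order $n$, denoted $\mathrm{QLS}(n)$, is an $n\times n$ array $(\phi_{ij})_{0\le i,j\le n-1}$ of unit vectors in $\mathbb{C}^n$ such that every row and every column forms an orthonormal basis of $\mathbb{C}^n$. Two unit vectors $u,v$ are phase equivalent, $u\sim v$, if $u=e^{i\alpha}v$ for some $\alpha\in\mathbb{R}$. The cardinality of a quantum Latin square is the number of distinct phase-equivalence classes among its $n^2$ entries. *)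

theory Defs
  imports "Jordan_Normal_Form.VS_Connect"
begin

definition schur_prod :: "complex vec \<Rightarrow> complex vec \<Rightarrow> complex vec" (infixl "\<odot>" 70) where
  "x \<odot> y = vec (dim_vec x) (\<lambda>k. x $ k * y $ k)"

text \<open>The vector space \<open>\<complex>\<^sup>n\<close> is \<^term>\<open>module_vec TYPE(complex) n\<close>, and the scalar product
  \<open>\<bullet>c\<close> is conjugate linear in its second argument.\<close>

definition unit_vector :: "nat \<Rightarrow> complex vec \<Rightarrow> bool" where
  "unit_vector n v \<longleftrightarrow> v \<in> carrier_vec n \<and> v \<bullet>c v = 1"

definition orthonormal_basis :: "nat \<Rightarrow> (nat \<Rightarrow> complex vec) \<Rightarrow> bool" where
  "orthonormal_basis n b \<longleftrightarrow>
     (\<forall>i<n. unit_vector n (b i)) \<and>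
     (\<forall>i<n. \<forall>j<n. i \<noteq> j \<longrightarrow> b i \<bullet>c b j = 0) \<and>
     vectorspace.basis class_ring (module_vec TYPE(complex) n) (b ` {..<n})"

text \<open>An \<open>n \<times> n\<close> array of vectors is a function of which only the values at indices below \<open>n\<close>
  matter.\<close>

definition quantum_latin_square :: "nat \<Rightarrow> (nat \<Rightarrow> nat \<Rightarrow> complex vec) \<Rightarrow> bool" where
  "quantum_latin_square n \<phi> \<longleftrightarrow>
     (\<forall>i<n. \<forall>j<n. unit_vector n (\<phi> i j)) \<and>
     (\<forall>i<n. orthonormal_basis n (\<lambda>j. \<phi> i j)) \<and>
     (\<forall>j<n. orthonormal_basis n (\<lambda>i. \<phi> i j))"

definition phase_equiv :: "nat \<Rightarrow> (complex vec \<times> complex vec) set" where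
  "phase_equiv n = {(u, v). unit_vector n u \<and> unit_vector n v \<and>
     (\<exists>\<alpha>::real. u = exp (\<i> * complex_of_real \<alpha>) \<cdot>\<^sub>v v)}"

definition qls_cardinality :: "nat \<Rightarrow> (nat \<Rightarrow> nat \<Rightarrow> complex vec) \<Rightarrow> nat" where
  "qls_cardinality n \<phi> = card ({\<phi> i j | i j. i < n \<and> j < n} // phase_equiv n)"

definition zeta :: complex where
  "zeta = exp (complex_of_real pi * \<i> / 4)"

text \<open>Residues modulo 8 are given by their representatives in \<open>{0..<8}\<close>; they only occur as
  exponents of \<^const>\<open>zeta\<close>, where the choice of representative is immaterial.\<close>

lemma zeta_power_mod_8: "zeta ^ (k mod 8) = zeta ^ k"
proof -
  have "zeta ^ 8 = exp (of_nat 8 * (complex_of_real pi * \<i> / 4))"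
    unfolding zeta_def by (rule exp_of_nat_mult [symmetric])
  also have "\<dots> = exp (2 * complex_of_real pi * \<i>)"
    by (simp add: field_simps)
  also have "\<dots> = 1"
    by simp
  finally have "zeta ^ 8 = 1" .
  then have "zeta ^ (8 * (k div 8) + k mod 8) = zeta ^ (k mod 8)"
    by (simp only: power_add power_mult power_one mult_1)
  then show ?thesis
    by simp
qed

definition A_mat :: "nat mat" where
  "A_mat = mat_of_rows_list 6
     [[0, 0, 0, 0, 0, 0],
      [0, 4, 2, 6, 6, 2],
      [0, 2, 4, 3, 7, 6],
      [0, 6, 1, 4, 2, 5],
      [0, 6, 5, 2, 4, 1],
      [0, 2, 6, 7, 3, 4]]"

definition H_mat :: "complex mat" where
  "H_mat = mat 6 6 (\<lambda>(r, s). zeta ^ (A_mat $$ (r, s)))"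

definition Phi19 :: "nat \<Rightarrow> nat \<Rightarrow> complex vec" where
  "Phi19 i j = complex_of_real (1 / sqrt 6) \<cdot>\<^sub>v (col H_mat i \<odot> col H_mat j)"

end

theory Submission
  imports Defs
begin

text \<open>Every entry of \<^const>\<open>H_mat\<close> has modulus 1, so multiplying the columns entrywise by a fixed
  column preserves scalar products, and the array is a quantum Latin square because the columns of
  \<^const>\<open>H_mat\<close> are pairwise orthogonal. The row of zeros in \<^const>\<open>A_mat\<close> makes the first
  coordinates of all entries of the array equal, so phase equivalent entries coincide; hence the
  cardinality is the number of distinct exponent vectors modulo 8.\<close>

text \<open>Orthonormality makes the matrix with rows \<open>b i\<close> invertible: its inverse has
  the conjugated vectors as columns. A nonzero determinant gives independent rows, and
  \<open>n\<close> independent vectors form a basis.\<close>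

lemma orthonormal_basisI:
  assumes carr: "\<And>i. i < n \<Longrightarrow> b i \<in> carrier_vec n"
    and orth: "\<And>i j. i < n \<Longrightarrow> j < n \<Longrightarrow> b i \<bullet>c b j = (if i = j then 1 else 0)"
  shows "orthonormal_basis n b"
proof -
  interpret vec_space "TYPE(complex)" n .
  define M where "M = mat_of_rows n (map b [0..<n])"
  define N where "N = mat_of_cols n (map (\<lambda>j. conjugate (b j)) [0..<n])"
  have M: "M \<in> carrier_mat n n" and N: "N \<in> carrier_mat n n"
    by (simp_all add: M_def N_def carrier_matI)
  have "M * N = 1\<^sub>m n"
  proof (rule eq_matI)
    fix i j assume "i < dim_row (1\<^sub>m n :: complex mat)" "j < dim_col (1\<^sub>m n :: complex mat)"
    then have ij: "i < n" "j < n" by simp_all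
    have "row M i = b i"
      unfolding M_def using ij carr by (simp add: mat_of_rows_row)
    moreover have "col N j = conjugate (b j)"
      unfolding N_def using ij carr by simp
    ultimately show "(M * N) $$ (i, j) = 1\<^sub>m n $$ (i, j)"
      using ij M N orth by simp
  qed (use M N in auto)
  then have "det M * det N = 1"
    using det_mult[OF M N] by simp
  then have "det M \<noteq> 0" by auto
  then have "lin_indpt (set (rows M))"
    by (rule det_not_0_imp_lin_indpt_rows[OF M])
  moreover have rows: "set (rows M) = b ` {..<n}"
    unfolding M_def using carr by (subst rows_mat_of_rows) auto
  \<comment> \<open>Repeated vectors would make the same scalar product both 1 and 0. Distinctness
    is what gives the set the size of the dimension.\<close>
  moreover have "inj_on b {..<n}"
    by (rule inj_onI) (metis lessThan_iff orth zero_neq_one)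
  then have "card (b ` {..<n}) = n"
    by (simp add: card_image)
  ultimately have "basis (b ` {..<n})"
    using carr by (intro dim_li_is_basis) (auto simp: dim_is_n)
  then show ?thesis
    unfolding orthonormal_basis_def unit_vector_def using carr orth by simp
qed

lemma quantum_latin_squareI:
  assumes carr: "\<And>i j. i < n \<Longrightarrow> j < n \<Longrightarrow> \<phi> i j \<in> carrier_vec n"
    and rows: "\<And>i j k. i < n \<Longrightarrow> j < n \<Longrightarrow> k < n \<Longrightarrow>
      \<phi> i j \<bullet>c \<phi> i k = (if j = k then 1 else 0)"
    and cols: "\<And>i j k. i < n \<Longrightarrow> j < n \<Longrightarrow> k < n \<Longrightarrow>
      \<phi> i k \<bullet>c \<phi> j k = (if i = j then 1 else 0)"
  shows "quantum_latin_square n \<phi>"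
  unfolding quantum_latin_square_def unit_vector_def
  using assms by (auto intro!: orthonormal_basisI)

text \<open>A phase relating two vectors with the same nonzero coordinate \<open>k\<close> is 1. The
  classes contain unit vectors outside \<open>S\<close> too, so they are counted through injectivity
  of the class map on \<open>S\<close>.\<close>

lemma card_quotient_phase_equiv:
  assumes unit: "\<And>v. v \<in> S \<Longrightarrow> unit_vector n v"
    and "k < n" and first: "\<And>v. v \<in> S \<Longrightarrow> v $ k = c" and "c \<noteq> 0"
  shows "card (S // phase_equiv n) = card S"
proof -
  have "inj_on (\<lambda>v. phase_equiv n `` {v}) S"
  proof (rule inj_onI)
    fix u v assume uv: "u \<in> S" "v \<in> S" "phase_equiv n `` {u} = phase_equiv n `` {v}"
    have "v = exp (\<i> * complex_of_real 0) \<cdot>\<^sub>v v"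
      by simp
    then have "(v, v) \<in> phase_equiv n"
      unfolding phase_equiv_def using unit[OF uv(2)] by blast
    with uv have "(u, v) \<in> phase_equiv n"
      by blast
    then obtain \<alpha> :: real where \<alpha>: "u = exp (\<i> * complex_of_real \<alpha>) \<cdot>\<^sub>v v"
      unfolding phase_equiv_def by blast
    have "dim_vec v = n"
      using unit[OF uv(2)] unfolding unit_vector_def by auto
    with \<alpha> have "u $ k = exp (\<i> * complex_of_real \<alpha>) * v $ k"
      using \<open>k < n\<close> by simp
    then have "exp (\<i> * complex_of_real \<alpha>) = 1"
      using first uv \<open>c \<noteq> 0\<close> by simp
    with \<alpha> show "u = v" by simp
  qed
  moreover have "S // phase_equiv n = (\<lambda>v. phase_equiv n `` {v}) ` S"
    unfolding quotient_def by blast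
  ultimately show ?thesis
    by (simp add: card_image)
qed

lemma zeta_Re_Im: "zeta = Complex (sqrt 2 / 2) (sqrt 2 / 2)"
proof -
  have "zeta = cis (pi / 4)"
    unfolding zeta_def cis_conv_exp by (simp add: mult.commute)
  then show ?thesis
    by (simp add: cis.ctr cos_45 sin_45)
qed

text \<open>Normal forms in which cancellation in sums of powers is visible to the
  simplifier.\<close>

lemma zeta_powers:
  "zeta ^ 2 = \<i>" "zeta ^ 3 = \<i> * zeta" "zeta ^ 4 = -1" "zeta ^ 5 = - zeta"
  "zeta ^ 6 = - \<i>" "zeta ^ 7 = - \<i> * zeta"
proof -
  show 2: "zeta ^ 2 = \<i>"
    by (simp add: zeta_Re_Im power2_eq_square complex_eq_iff)
  show 3: "zeta ^ 3 = \<i> * zeta"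
    using 2 by (simp add: power3_eq_cube power2_eq_square)
  show 4: "zeta ^ 4 = -1"
    using 2 power_add[of zeta 2 2] by simp
  show "zeta ^ 5 = - zeta" "zeta ^ 6 = - \<i>" "zeta ^ 7 = - \<i> * zeta"
    using power_add[of zeta 4 1] power_add[of zeta 4 2] power_add[of zeta 4 3] 2 3 4 by simp_all
qed

lemma zeta_mult_cnj: "zeta * cnj zeta = 1"
  by (simp add: zeta_Re_Im complex_eq_iff)

lemma zeta_power_mult_cnj: "zeta ^ a * cnj (zeta ^ a) = 1"
  using zeta_mult_cnj by (simp flip: power_mult_distrib)

text \<open>Conjugation inverts an eighth root of unity; the factor 7 stands for -1 modulo 8 and
  keeps exponents natural.\<close>

lemma cnj_zeta_power: "cnj (zeta ^ a) = zeta ^ (7 * a)"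
proof -
  have "cnj zeta = zeta ^ 7"
    \<comment> \<open>Powers are reduced before \<open>zeta\<close> is expanded, because
      \<open>zeta_powers\<close> matches only the folded constant.\<close>
    by (simp add: zeta_powers complex_eq_iff) (simp add: zeta_Re_Im)
  then show ?thesis
    by (simp add: power_mult)
qed

lemma inj_on_zeta_power: "inj_on (\<lambda>a. zeta ^ a) {..<8}"
proof (rule inj_onI)
  fix a b :: nat assume "a \<in> {..<8}" "b \<in> {..<8}" and eq: "zeta ^ a = zeta ^ b"
  then have "a \<in> {0, 1, 2, 3, 4, 5, 6, 7}" "b \<in> {0, 1, 2, 3, 4, 5, 6, 7}" by auto
  with eq show "a = b"
    by (auto simp: zeta_powers complex_eq_iff) (auto simp: zeta_Re_Im)
qed

lemma A_mat_rows:
  "r < 6 \<Longrightarrow> s < 6 \<Longrightarrow> A_mat $$ (r, s) =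
    [[0, 0, 0, 0, 0, 0], [0, 4, 2, 6, 6, 2], [0, 2, 4, 3, 7, 6],
     [0, 6, 1, 4, 2, 5], [0, 6, 5, 2, 4, 1], [0, 2, 6, 7, 3, 4]] ! r ! s"
  by (simp add: A_mat_def mat_of_rows_list_def)

lemma less_6_iff: "i < (6::nat) \<longleftrightarrow> i \<in> {0, 1, 2, 3, 4, 5}"
  by auto

text \<open>\<open>H_mat\<close> is a complex Hadamard matrix. With exponent differences reduced
  modulo 8, this is a finite check over 36 pairs of columns.\<close>

lemma H_mat_columns_orthogonal:
  assumes "j < 6" "l < 6"
  shows "(\<Sum>r<6. zeta ^ (A_mat $$ (r, j)) * cnj (zeta ^ (A_mat $$ (r, l)))) = (if j = l then 6 else 0)"
proof -
  have "(\<Sum>r<6. zeta ^ (A_mat $$ (r, j)) * cnj (zeta ^ (A_mat $$ (r, l))))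
      = (\<Sum>r<6. zeta ^ ((A_mat $$ (r, j) + 7 * A_mat $$ (r, l)) mod 8))"
    by (simp only: zeta_power_mod_8 power_add cnj_zeta_power)
  also have "\<dots> = (if j = l then 6 else 0)"
    using assms unfolding less_6_iff
    by (auto simp: A_mat_rows lessThan_nat_numeral lessThan_Suc zeta_powers)
  finally show ?thesis .
qed

lemma Phi19_eq_vec:
  assumes "i < 6" "j < 6"
  shows "Phi19 i j =
    vec 6 (\<lambda>r. complex_of_real (1 / sqrt 6) * zeta ^ (A_mat $$ (r, i) + A_mat $$ (r, j)))"
  using assms by (auto simp: Phi19_def schur_prod_def H_mat_def power_add)

text \<open>This symmetry reduces the column condition to the row condition.\<close>

lemma Phi19_commute: "i < 6 \<Longrightarrow> j < 6 \<Longrightarrow> Phi19 i j = Phi19 j i"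
  by (simp add: Phi19_eq_vec add.commute)

lemma Phi19_row_orthonormal:
  assumes "i < 6" "j < 6" "k < 6"
  shows "Phi19 i j \<bullet>c Phi19 i k = (if j = k then 1 else 0)"
proof -
  define c where "c = complex_of_real (1 / sqrt 6)"
  let ?A = "\<lambda>r s. A_mat $$ (r, s)"
  have c: "c * cnj c = 1 / 6"
    by (simp add: c_def flip: of_real_mult)
  have "Phi19 i j \<bullet>c Phi19 i k
      = (\<Sum>r<6. (c * zeta ^ (?A r i + ?A r j)) * cnj (c * zeta ^ (?A r i + ?A r k)))"
    using assms by (simp add: Phi19_eq_vec scalar_prod_def c_def atLeast0LessThan)
  also have "\<dots> = (\<Sum>r<6. (c * cnj c) * (zeta ^ ?A r i * cnj (zeta ^ ?A r i)) *
      (zeta ^ ?A r j * cnj (zeta ^ ?A r k)))"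
    by (rule sum.cong) (simp_all add: power_add)
  also have "\<dots> = (c * cnj c) * (\<Sum>r<6. zeta ^ ?A r j * cnj (zeta ^ ?A r k))"
    unfolding zeta_power_mult_cnj by (simp add: sum_distrib_left)
  finally show ?thesis
    using assms by (simp only: H_mat_columns_orthogonal c) simp
qed

lemma quantum_latin_square_Phi19: "quantum_latin_square 6 Phi19"
proof (rule quantum_latin_squareI)
  show "Phi19 i j \<in> carrier_vec 6" if "i < 6" "j < 6" for i j
    using that by (simp add: Phi19_eq_vec)
  show row: "Phi19 i j \<bullet>c Phi19 i k = (if j = k then 1 else 0)" if "i < 6" "j < 6" "k < 6" for i j k
    using that by (rule Phi19_row_orthonormal)
  show "Phi19 i k \<bullet>c Phi19 j k = (if i = j then 1 else 0)" if "i < 6" "j < 6" "k < 6" for i j k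
    using that row[of k i j] by (simp add: Phi19_commute)
qed

text \<open>Canonical residues turn equality of array entries into equality of lists of
  numerals.\<close>

definition phi19_exponents :: "nat \<Rightarrow> nat \<Rightarrow> nat list" where
  "phi19_exponents i j = map (\<lambda>r. (A_mat $$ (r, i) + A_mat $$ (r, j)) mod 8) [0..<6]"

definition zeta_vec :: "nat list \<Rightarrow> complex vec" where
  "zeta_vec xs = vec (length xs) (\<lambda>r. complex_of_real (1 / sqrt 6) * zeta ^ (xs ! r))"

text \<open>The dimension determines the length, and each coordinate determines its exponent below
  8.\<close>

lemma inj_on_zeta_vec: "inj_on zeta_vec {xs. set xs \<subseteq> {..<8}}"
proof (rule inj_onI)
  fix xs ys assume xs: "xs \<in> {xs. set xs \<subseteq> {..<8}}" and ys: "ys \<in> {xs. set xs \<subseteq> {..<8}}"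
    and eq: "zeta_vec xs = zeta_vec ys"
  have len: "length xs = length ys"
    using arg_cong[OF eq, of dim_vec] by (simp add: zeta_vec_def)
  show "xs = ys"
  proof (rule nth_equalityI[OF len])
    fix r assume r: "r < length xs"
    have "zeta_vec xs $ r = zeta_vec ys $ r"
      by (simp add: eq)
    then have "zeta ^ (xs ! r) = zeta ^ (ys ! r)"
      using r len by (simp add: zeta_vec_def)
    moreover have "xs ! r \<in> {..<8}" "ys ! r \<in> {..<8}"
      using xs ys r len by (metis mem_Collect_eq nth_mem subsetD)+
    ultimately show "xs ! r = ys ! r"
      using inj_on_zeta_power by (meson inj_onD)
  qed
qed

lemma Phi19_eq_zeta_vec: "i < 6 \<Longrightarrow> j < 6 \<Longrightarrow> Phi19 i j = zeta_vec (phi19_exponents i j)"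
  by (auto simp: Phi19_eq_vec zeta_vec_def phi19_exponents_def zeta_power_mod_8)

text \<open>Symmetry leaves 21 unordered index pairs. The pairs {0,1}, {2,5} and {3,4} share the
  list \<open>[0, 4, 2, 6, 6, 2]\<close>; there is no other coincidence.\<close>

lemma card_phi19_exponents: "card {phi19_exponents i j | i j. i < 6 \<and> j < 6} = 19"
proof -
  \<comment> \<open>Unions over numeric ranges can be expanded by simp into an explicit finite
    set.\<close>
  have "{phi19_exponents i j | i j. i < 6 \<and> j < 6} = (\<Union>i<6. \<Union>j<6. {phi19_exponents i j})"
    by blast
  also have "card \<dots> = 19"
    by (simp add: lessThan_nat_numeral lessThan_Suc phi19_exponents_def upt_rec A_mat_rows)
      (simp add: card_insert_if numeral_eq_Suc)
  finally show ?thesis .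
qed

theorem theorem1:
  shows "quantum_latin_square 6 Phi19 \<and> qls_cardinality 6 Phi19 = 19"
proof
  show "quantum_latin_square 6 Phi19"
    by (rule quantum_latin_square_Phi19)
  let ?S = "{Phi19 i j | i j. i < 6 \<and> j < 6}" and ?E = "{phi19_exponents i j | i j. i < 6 \<and> j < 6}"
  have "qls_cardinality 6 Phi19 = card ?S"
    unfolding qls_cardinality_def
  proof (rule card_quotient_phase_equiv)
    show "unit_vector 6 v" if "v \<in> ?S" for v
      using that quantum_latin_square_Phi19 unfolding quantum_latin_square_def by blast
    show "v $ 0 = complex_of_real (1 / sqrt 6)" if "v \<in> ?S" for v
      using that by (auto simp: Phi19_eq_vec A_mat_rows less_6_iff)
  qed simp_all
  also have "?S = zeta_vec ` ?E"
    by (auto simp: Phi19_eq_zeta_vec image_def) (metis Phi19_eq_zeta_vec)+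
  also have "card \<dots> = card ?E"
    by (rule card_image, rule inj_on_subset[OF inj_on_zeta_vec]) (auto simp: phi19_exponents_def)
  finally show "qls_cardinality 6 Phi19 = 19"
    by (simp add: card_phi19_exponents)
qed

end
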